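(* Let $A\in\mathbb{R}^{n\times n}$ be inverse nonnegative, i.e., $A$ is nonsingular and $A^{-1}\ge 0$ entrywise. Then $$r(A)=\frac{1}{e^TA^{-1}e},$$ where $e=(1,\dots,1)^T\in\mathbb{R}^n$.
   Context: The regularity radius of $A$ is $r(A)=\min\{\delta\ge 0 : [A-\delta ee^T,A+\delta ee^T]\text{ is singular}\}$, where $[A-\delta ee^T,A+\delta ee^T]$ is the set of all real matrices $A'$ with $A-\delta ee^T\le A'\le A+\delta ee^T$ entrywise, and this set is called singular if it contains at least one singular matrix. *)

theory Defs
  imports "HOL-Analysis.Analysis"
begin

(* The order on vectors, and hence on matrices (vectors of row vectors), is componentwise,
   so {L..U} is the interval matrix [L, U]. *)

definition ones_matrix :: "real^'n^'n" where
  "ones_matrix = (columnvector (1 :: real^'n) :: real^1^'n) ** (rowvector (1 :: real^'n) :: real^'n^1)"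

definition singular_matrix_set :: "(real^'n^'n) set \<Rightarrow> bool" where
  "singular_matrix_set S \<longleftrightarrow> (\<exists>B\<in>S. \<not> invertible B)"

(* LEAST is the minimum proper (not an infimum): the value is specified only if
   the minimum is attained. *)
definition regularity_radius :: "real^'n^'n \<Rightarrow> real" where
  "regularity_radius A =
     (LEAST \<delta>. 0 \<le> \<delta> \<and>
        singular_matrix_set {A - \<delta> *\<^sub>R ones_matrix .. A + \<delta> *\<^sub>R ones_matrix})"

end

(* With e the all-ones vector and s = e^T A^-1 e, the matrix A - (1/s) e e^T kills A^-1 e, so
   the interval of radius 1/s is singular. Conversely, if B x = 0 with |A - B| <= delta e e^T and
   x nonzero, then x = A^-1 (A - B) x, and |(A - B) x| <= delta ||x||_1 e entrywise. As A^-1 >= 0,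
   summing the entries of x gives ||x||_1 <= delta s ||x||_1, so delta >= 1/s. *)

theory Submission
  imports Defs
begin

lemma ones_matrix_nth [simp]: "ones_matrix $ i $ j = 1"
  by (simp add: ones_matrix_def matrix_matrix_mult_def columnvector_def rowvector_def)

lemma mem_interval_matrix_iff:
  fixes A B :: "real^'n^'n"
  shows "B \<in> {A - \<delta> *\<^sub>R ones_matrix .. A + \<delta> *\<^sub>R ones_matrix} \<longleftrightarrow>
    (\<forall>i j. \<bar>A $ i $ j - B $ i $ j\<bar> \<le> \<delta>)"
  by (auto simp: less_eq_vec_def abs_le_iff algebra_simps)

lemma not_invertible_iff_kernel:
  fixes A :: "real^'n^'n"
  shows "\<not> invertible A \<longleftrightarrow> (\<exists>x. x \<noteq> 0 \<and> A *v x = 0)"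
  by (auto simp: invertible_left_inverse matrix_left_invertible_ker)

lemma matrix_inv_inverse:
  fixes A :: "real^'n^'n"
  assumes "invertible A"
  shows matrix_inv_right: "A ** matrix_inv A = mat 1"
    and matrix_inv_left: "matrix_inv A ** A = mat 1"
  using someI_ex[OF assms[unfolded invertible_def]] unfolding matrix_inv_def by blast+

lemma inner_one_mult_one:
  fixes M :: "real^'n^'n"
  shows "1 \<bullet> (M *v 1) = (\<Sum>i\<in>UNIV. \<Sum>j\<in>UNIV. M $ i $ j)"
  by (simp add: inner_vec_def matrix_vector_mult_def)

text \<open>A nonnegative matrix whose entries sum to 0 vanishes, but an inverse cannot vanish.
  Positivity keeps the quotient in the theorem away from the default value
  \<open>1 / 0 = 0\<close>.\<close>

lemma inner_one_inverse_pos: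
  fixes A :: "real^'n^'n"
  assumes "invertible A" "0 \<le> matrix_inv A"
  shows "0 < 1 \<bullet> (matrix_inv A *v 1)"
proof -
  let ?M = "matrix_inv A"
  have nonneg: "0 \<le> ?M $ i $ j" for i j
    using assms(2) by (simp add: less_eq_vec_def)
  have "?M \<noteq> 0"
  proof
    assume "?M = 0"
    then have "(mat 1 :: real^'n^'n) = 0"
      using matrix_inv_right[OF assms(1)] by simp
    then show False
      by (simp add: vec_eq_iff mat_def) (metis zero_neq_one)
  qed
  then obtain i j where "?M $ i $ j \<noteq> 0"
    by (auto simp: vec_eq_iff)
  then have "0 < ?M $ i $ j"
    using nonneg[of i j] by linarith
  \<comment> \<open>One positive entry bounds its row sum from below, and the row sum bounds the
    total.\<close>
  also have "\<dots> \<le> (\<Sum>j\<in>UNIV. ?M $ i $ j)"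
    by (rule member_le_sum) (auto simp: nonneg)
  also have "\<dots> \<le> (\<Sum>i\<in>UNIV. \<Sum>j\<in>UNIV. ?M $ i $ j)"
    by (rule member_le_sum) (auto simp: nonneg intro!: sum_nonneg)
  finally show ?thesis
    by (simp add: inner_one_mult_one)
qed

text \<open>For \<open>x = matrix_inv A *v 1\<close>, both \<open>A *v x\<close> and the scaled
  rank-one term applied to \<open>x\<close> equal \<open>1\<close>: \<open>ones_matrix\<close> sends
  \<open>x\<close> to \<open>1 \<bullet> x\<close> times the vector \<open>1\<close>, and the scalar
  cancels that factor.\<close>

lemma kernel_rank_one_perturbation:
  fixes A :: "real^'n^'n"
  assumes "invertible A" and s: "1 \<bullet> (matrix_inv A *v 1) \<noteq> 0"
  shows "(A - (1 / (1 \<bullet> (matrix_inv A *v 1))) *\<^sub>R ones_matrix) *v (matrix_inv A *v 1) = 0"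
proof -
  have "ones_matrix *v x = (1 \<bullet> x) *\<^sub>R 1" for x :: "real^'n"
    by (simp add: vec_eq_iff matrix_vector_mult_def inner_vec_def)
  moreover have "A *v (matrix_inv A *v 1) = 1"
    using assms(1) by (simp add: matrix_vector_mul_assoc matrix_inv_right)
  ultimately show ?thesis
    using s by (simp add: matrix_vector_mult_diff_rdistrib flip: scaleR_matrix_vector_assoc)
qed

lemma singular_interval_radius_ge:
  fixes A B :: "real^'n^'n"
  assumes "invertible A" "0 \<le> matrix_inv A"
    and "B \<in> {A - \<delta> *\<^sub>R ones_matrix .. A + \<delta> *\<^sub>R ones_matrix}"
    and "\<not> invertible B"
  shows "1 \<le> \<delta> * (1 \<bullet> (matrix_inv A *v 1))"
proof -
  let ?M = "matrix_inv A"
  obtain x where x: "x \<noteq> 0" "B *v x = 0"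
    using assms(4) not_invertible_iff_kernel by blast
  define y where "y = (A - B) *v x"
  \<comment> \<open>The l1 norm is dual to the max norm in which the rows of \<open>A - B\<close>
    are bounded by \<delta>, so every entry of \<open>y\<close> obeys the same bound.\<close>
  define N where "N = (\<Sum>i\<in>UNIV. \<bar>x $ i\<bar>)"
  have "A *v x = y"
    by (simp add: y_def matrix_vector_mult_diff_rdistrib x(2))
  then have x_eq: "x = ?M *v y"
    by (metis assms(1) matrix_inv_left matrix_vector_mul_assoc matrix_vector_mul_lid)
  have nonneg: "0 \<le> ?M $ i $ j" for i j
    using assms(2) by (simp add: less_eq_vec_def)
  have y_le: "\<bar>y $ i\<bar> \<le> \<delta> * N" for i
  proof -
    have "\<bar>y $ i\<bar> \<le> (\<Sum>j\<in>UNIV. \<bar>A $ i $ j - B $ i $ j\<bar> * \<bar>x $ j\<bar>)"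
      by (simp add: y_def matrix_vector_mult_def sum_abs flip: abs_mult)
    also have "\<dots> \<le> \<delta> * N"
      unfolding N_def sum_distrib_left
      by (intro sum_mono mult_right_mono) (use assms(3) mem_interval_matrix_iff in blast, simp)
    finally show ?thesis .
  qed
  have x_le: "\<bar>x $ i\<bar> \<le> (\<Sum>j\<in>UNIV. ?M $ i $ j) * (\<delta> * N)" for i
  proof -
    have "\<bar>x $ i\<bar> = \<bar>\<Sum>j\<in>UNIV. ?M $ i $ j * y $ j\<bar>"
      by (subst x_eq) (simp add: matrix_vector_mult_def)
    also have "\<dots> \<le> (\<Sum>j\<in>UNIV. \<bar>?M $ i $ j * y $ j\<bar>)"
      by (rule sum_abs)
    \<comment> \<open>Nonnegativity of \<open>?M\<close> removes the absolute values from its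
      entries, so that the sum over \<open>i\<close> yields exactly
      \<open>1 \<bullet> (?M *v 1)\<close>.\<close>
    also have "\<dots> \<le> (\<Sum>j\<in>UNIV. ?M $ i $ j * (\<delta> * N))"
      by (intro sum_mono) (simp add: abs_mult nonneg y_le mult_left_mono)
    finally show ?thesis
      by (simp add: sum_distrib_right)
  qed
  have "N \<le> (\<Sum>i\<in>UNIV. (\<Sum>j\<in>UNIV. ?M $ i $ j) * (\<delta> * N))"
    \<comment> \<open>Only the \<open>N\<close> on the left is expanded; the one on the right stays
      folded, to be cancelled at the end.\<close>
    unfolding N_def[symmetric] by (subst N_def) (intro sum_mono x_le)
  also have "\<dots> = \<delta> * (1 \<bullet> (?M *v 1)) * N"
    by (simp add: inner_one_mult_one flip: sum_distrib_right)
  finally have "1 * N \<le> \<delta> * (1 \<bullet> (?M *v 1)) * N"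
    by simp
  moreover have "0 < N"
  proof -
    obtain i where "x $ i \<noteq> 0"
      using x(1) by (auto simp: vec_eq_iff)
    then show ?thesis
      unfolding N_def by (intro sum_pos2[of _ i]) auto
  qed
  ultimately show ?thesis
    by (simp only: mult_le_cancel_right_pos)
qed

theorem mainTheorem9:
  fixes A :: "real^'n^'n"
  assumes "invertible A"
    and "0 \<le> matrix_inv A"
  shows "regularity_radius A = 1 / ((1 :: real^'n) \<bullet> (matrix_inv A *v 1))"
  unfolding regularity_radius_def
\<comment> \<open>Two goals: the claimed value is attained, and it is a lower bound.\<close>
proof (rule Least_equality)
  let ?s = "(1 :: real^'n) \<bullet> (matrix_inv A *v 1)"
  let ?B = "A - (1 / ?s) *\<^sub>R ones_matrix"
  have s: "0 < ?s"
    using assms by (rule inner_one_inverse_pos)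
  then have "matrix_inv A *v 1 \<noteq> 0"
    by (metis inner_zero_right less_irrefl)
  moreover have "?B *v (matrix_inv A *v 1) = 0"
    using assms(1) s by (intro kernel_rank_one_perturbation) auto
  ultimately have "\<not> invertible ?B"
    using not_invertible_iff_kernel by blast
  \<comment> \<open>\<open>?B\<close> is the lower endpoint of the interval matrix.\<close>
  moreover have "?B \<in> {A - (1 / ?s) *\<^sub>R ones_matrix .. A + (1 / ?s) *\<^sub>R ones_matrix}"
    unfolding mem_interval_matrix_iff using s by simp
  ultimately show "0 \<le> 1 / ?s \<and>
      singular_matrix_set {A - (1 / ?s) *\<^sub>R ones_matrix .. A + (1 / ?s) *\<^sub>R ones_matrix}"
    unfolding singular_matrix_set_def using s by (meson divide_nonneg_pos zero_le_one)
  fix \<delta> :: real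
  assume "0 \<le> \<delta> \<and> singular_matrix_set {A - \<delta> *\<^sub>R ones_matrix .. A + \<delta> *\<^sub>R ones_matrix}"
  then have "1 \<le> \<delta> * ?s"
    unfolding singular_matrix_set_def using singular_interval_radius_ge[OF assms] by blast
  then show "1 / ?s \<le> \<delta>"
    using s by (simp add: pos_divide_le_eq)
qed

end
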